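(* For every integer $d\geq 1$ there exist rational self-maps $f:\mathbb{P}^2\to\mathbb{P}^2$ of the complex projective plane of degree $d$ without holomorphic fixed points.
   Context: $\mathbb{P}^2$ is the complex projective plane. A meromorphic (equivalently, rational) self-map $f:\mathbb{P}^2\to\mathbb{P}^2$ is a holomorphic map from $\mathbb{P}^2$ minus a finite set of points to $\mathbb{P}^2$; the closure of its graph is an algebraic subvariety of $\mathbb{P}^2\times\mathbb{P}^2$. The map need not be holomorphic everywhere. The degree of $f$ is its topological degree, i.e. the number of preimages of a generic point. A holomorphic fixed point of $f$ is a point $p\in\mathbb{P}^2$ such that $f$ is (extends to be) holomorphic in a neighborhood of $p$ and $f(p)=p$. *)

theory Defs
  imports "HOL-Analysis.Analysis"
begin

section \<open>The complex projective plane\<close>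

definition proj_rel :: "complex^3 \<Rightarrow> complex^3 \<Rightarrow> bool" where
  "proj_rel v w \<longleftrightarrow> v \<noteq> 0 \<and> w \<noteq> 0 \<and> (\<exists>c. c \<noteq> 0 \<and> w = c *s v)"

text \<open>The relation is a partial equivalence relation with domain the nonzero vectors, so
  \<open>proj v\<close> is the point with homogeneous coordinates \<open>v\<close> only when \<open>v \<noteq> 0\<close>.\<close>

quotient_type cp2 = "complex^3" / partial: proj_rel
  morphisms hom_coords proj
proof (rule part_equivpI)
  have "proj_rel 1 1"
    unfolding proj_rel_def by (intro conjI exI[of _ 1]) (simp_all add: vec_eq_iff)
  then show "\<exists>x. proj_rel x x" by blast
  show "symp proj_rel"
  proof (rule sympI)
    fix v w assume "proj_rel v w"
    then obtain c where c: "v \<noteq> 0" "w \<noteq> 0" "c \<noteq> 0" "w = c *s v"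
      by (auto simp: proj_rel_def)
    have "v = inverse c *s w" using c(3) unfolding c(4) by (simp add: vector_smult_assoc)
    moreover have "inverse c \<noteq> 0" using c(3) by simp
    ultimately show "proj_rel w v"
      unfolding proj_rel_def using c(1,2) by blast
  qed
  show "transp proj_rel"
  proof (rule transpI)
    fix u v w assume "proj_rel u v" "proj_rel v w"
    then obtain b c where bc: "u \<noteq> 0" "w \<noteq> 0" "b \<noteq> 0" "v = b *s u" "c \<noteq> 0" "w = c *s v"
      by (auto simp: proj_rel_def)
    have "w = (c * b) *s u" unfolding bc(6) bc(4) by (rule vector_smult_assoc)
    moreover have "c * b \<noteq> 0" using bc(3,5) by simp
    ultimately show "proj_rel u w"
      unfolding proj_rel_def using bc(1,2) by blast
  qed
qed

lemma proj_eq_iff: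
  assumes "v \<noteq> 0" "w \<noteq> 0"
  shows "proj v = proj w \<longleftrightarrow> (\<exists>c. c \<noteq> 0 \<and> w = c *s v)"
proof -
  have refl: "proj_rel u u" if "u \<noteq> 0" for u
    unfolding proj_rel_def using that by (intro conjI exI[of _ 1]) simp_all
  have "proj v = proj w \<longleftrightarrow> proj_rel v w"
    using Quotient_rel[OF Quotient_cp2, of v w] refl[OF assms(1)] refl[OF assms(2)] by blast
  then show ?thesis using assms by (simp add: proj_rel_def)
qed

lemma hom_coords_nonzero: "hom_coords p \<noteq> 0"
  using Quotient_rep_reflp[OF Quotient_cp2, of p] by (simp add: proj_rel_def)

lemma proj_hom_coords: "proj (hom_coords p) = p"
  by (rule Quotient_abs_rep[OF Quotient_cp2])

text \<open>The quotient topology; \<open>cp2 \<times> cp2\<close> then carries the product topology of the library.\<close>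

instantiation cp2 :: topological_space
begin

definition open_cp2 :: "cp2 set \<Rightarrow> bool" where
  "open_cp2 U \<longleftrightarrow> open {v. v \<noteq> 0 \<and> proj v \<in> U}"

instance
proof
  have "{v::complex^3. v \<noteq> 0 \<and> proj v \<in> UNIV} = - {0}" by auto
  then show "open (UNIV :: cp2 set)"
    using open_Compl[OF closed_singleton[of "0 :: complex^3"]] by (simp only: open_cp2_def)
next
  fix S T :: "cp2 set" assume "open S" "open T"
  then have "open ({v. v \<noteq> 0 \<and> proj v \<in> S} \<inter> {v. v \<noteq> 0 \<and> proj v \<in> T})"
    unfolding open_cp2_def by (rule open_Int)
  moreover have "{v. v \<noteq> 0 \<and> proj v \<in> S \<inter> T} =
      {v. v \<noteq> 0 \<and> proj v \<in> S} \<inter> {v. v \<noteq> 0 \<and> proj v \<in> T}" by auto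
  ultimately show "open (S \<inter> T)"
    unfolding open_cp2_def by simp
next
  fix K :: "cp2 set set" assume "\<forall>S\<in>K. open S"
  then have "open (\<Union>S\<in>K. {v. v \<noteq> 0 \<and> proj v \<in> S})"
    unfolding open_cp2_def by (rule open_UN)
  moreover have "{v. v \<noteq> 0 \<and> proj v \<in> \<Union>K} = (\<Union>S\<in>K. {v. v \<noteq> 0 \<and> proj v \<in> S})" by auto
  ultimately show "open (\<Union>K)"
    unfolding open_cp2_def by simp
qed

end

section \<open>The affine atlas and holomorphic maps\<close>

definition affine_param :: "3 \<Rightarrow> complex^2 \<Rightarrow> cp2" where
  "affine_param i a =
     (if i = 1 then proj (vector [1, a$1, a$2])
      else if i = 2 then proj (vector [a$1, 1, a$2])
      else proj (vector [a$1, a$2, 1]))"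

definition affine_domain :: "3 \<Rightarrow> cp2 set" where
  "affine_domain i = {p. hom_coords p $ i \<noteq> 0}"

definition affine_coord :: "3 \<Rightarrow> cp2 \<Rightarrow> complex^2" where
  "affine_coord i p = (let v = hom_coords p in
     if i = 1 then vector [v$2 / v$1, v$3 / v$1]
     else if i = 2 then vector [v$1 / v$2, v$3 / v$2]
     else vector [v$1 / v$3, v$2 / v$3])"

lemma hom_coords_proj:
  assumes "v \<noteq> 0"
  obtains c where "c \<noteq> 0" "hom_coords (proj v) = c *s v"
  using proj_eq_iff[OF assms hom_coords_nonzero, of "proj v"] unfolding proj_hom_coords by blast

lemma affine_domain_proj:
  assumes "v \<noteq> 0"
  shows "proj v \<in> affine_domain i \<longleftrightarrow> v $ i \<noteq> 0"
proof -
  obtain c where "c \<noteq> 0" "hom_coords (proj v) = c *s v"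
    by (rule hom_coords_proj[OF assms])
  then show ?thesis by (simp add: affine_domain_def)
qed

lemma affine_coord_proj:
  assumes "v \<noteq> 0"
  shows "affine_coord i (proj v) =
    (if i = 1 then vector [v$2 / v$1, v$3 / v$1]
     else if i = 2 then vector [v$1 / v$2, v$3 / v$2]
     else vector [v$1 / v$3, v$2 / v$3])"
proof -
  obtain c where "c \<noteq> 0" "hom_coords (proj v) = c *s v"
    by (rule hom_coords_proj[OF assms])
  then show ?thesis by (simp add: affine_coord_def Let_def)
qed

lemma affine_vector_nonzero:
  "vector [1, x, y] \<noteq> (0 :: complex^3)"
  "vector [x, 1, y] \<noteq> (0 :: complex^3)"
  "vector [x, y, 1] \<noteq> (0 :: complex^3)"
  by (auto simp: vec_eq_iff forall_3)

lemma affine_param_in_domain: "affine_param i a \<in> affine_domain i"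
  using exhaust_3[of i] by (auto simp: affine_param_def affine_domain_proj affine_vector_nonzero)

lemma affine_coord_param: "affine_coord i (affine_param i a) = a"
proof -
  have "vector [a$1, a$2] = a"
    by (simp add: vec_eq_iff forall_2)
  then show ?thesis
    by (simp add: affine_param_def affine_coord_proj affine_vector_nonzero)
qed

lemma affine_param_coord:
  assumes "p \<in> affine_domain i"
  shows "affine_param i (affine_coord i p) = p"
proof -
  define v where "v = hom_coords p"
  have v: "v \<noteq> 0" "p = proj v" "v $ i \<noteq> 0"
    using assms by (auto simp: v_def hom_coords_nonzero proj_hom_coords affine_domain_def)
  have eq: "proj w = proj v" if "w \<noteq> 0" "v = v $ i *s w" for w
    using that v proj_eq_iff by blast
  consider "i = 1" | "i = 2" | "i = 3"
    using exhaust_3 by blast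
  then show ?thesis
  proof cases
    case 1
    have "v = v $ i *s vector [1, v$2 / v$1, v$3 / v$1]"
      using v(3) 1 by (simp add: vec_eq_iff forall_3)
    from eq[OF affine_vector_nonzero(1) this] show ?thesis
      using 1 v(1) by (simp add: affine_param_def affine_coord_proj v(2))
  next
    case 2
    have "v = v $ i *s vector [v$1 / v$2, 1, v$3 / v$2]"
      using v(3) 2 by (simp add: vec_eq_iff forall_3)
    from eq[OF affine_vector_nonzero(2) this] show ?thesis
      using 2 v(1) by (simp add: affine_param_def affine_coord_proj v(2))
  next
    case 3
    have "v = v $ i *s vector [v$1 / v$3, v$2 / v$3, 1]"
      using v(3) 3 by (simp add: vec_eq_iff forall_3)
    from eq[OF affine_vector_nonzero(3) this] show ?thesis
      using 3 v(1) by (simp add: affine_param_def affine_coord_proj v(2))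
  qed
qed

text \<open>Holomorphy in several variables: existence of a complex-linear Frechet derivative.\<close>

definition holomorphic_vec_on :: "(complex^'n \<Rightarrow> complex^'m) \<Rightarrow> (complex^'n) set \<Rightarrow> bool" where
  "holomorphic_vec_on F A \<longleftrightarrow>
     open A \<and>
     (\<forall>a\<in>A. \<exists>F'. (F has_derivative F') (at a) \<and> Vector_Spaces.linear (*s) (*s) F')"

definition cp2_holomorphic_on :: "(cp2 \<Rightarrow> cp2) \<Rightarrow> cp2 set \<Rightarrow> bool" where
  "cp2_holomorphic_on f V \<longleftrightarrow>
     open V \<and> continuous_on V f \<and>
     (\<forall>i j. holomorphic_vec_on (\<lambda>a. affine_coord j (f (affine_param i a)))
              {a. affine_param i a \<in> V \<and> f (affine_param i a) \<in> affine_domain j})"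

section \<open>Algebraic subsets\<close>

definition monomial_fun :: "('n::finite \<Rightarrow> nat) \<Rightarrow> complex^'n \<Rightarrow> complex" where
  "monomial_fun e z = (\<Prod>i\<in>UNIV. z $ i ^ e i)"

definition exponents :: "nat \<Rightarrow> (3 \<Rightarrow> nat) set" where
  "exponents k = {e. (\<Sum>i\<in>UNIV. e i) = k}"

lemma finite_exponents: "finite (exponents k)"
proof (rule finite_subset)
  show "exponents k \<subseteq> Pi\<^sub>E UNIV (\<lambda>_. {..k})"
    by (auto simp: exponents_def intro: member_le_sum)
  show "finite (Pi\<^sub>E (UNIV :: 3 set) (\<lambda>_. {..k}))"
    by (intro finite_PiE) auto
qed

definition homogeneous_poly :: "nat \<Rightarrow> (complex^3 \<Rightarrow> complex) \<Rightarrow> bool" where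
  "homogeneous_poly k P \<longleftrightarrow>
     (\<exists>c. \<forall>z. P z = (\<Sum>e\<in>exponents k. c e * monomial_fun e z))"

definition bihomogeneous_poly ::
    "nat \<Rightarrow> nat \<Rightarrow> (complex^3 \<Rightarrow> complex^3 \<Rightarrow> complex) \<Rightarrow> bool" where
  "bihomogeneous_poly k l P \<longleftrightarrow>
     (\<exists>c. \<forall>z w. P z w =
       (\<Sum>e\<in>exponents k. \<Sum>e'\<in>exponents l. c e e' * monomial_fun e z * monomial_fun e' w))"

definition algebraic_cp2 :: "cp2 set \<Rightarrow> bool" where
  "algebraic_cp2 Z \<longleftrightarrow>
     (\<exists>\<P>. finite \<P> \<and> (\<forall>P\<in>\<P>. \<exists>k. homogeneous_poly k P) \<and>
       (\<forall>z. z \<noteq> 0 \<longrightarrow> (proj z \<in> Z \<longleftrightarrow> (\<forall>P\<in>\<P>. P z = 0))))"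

definition algebraic_cp2_prod :: "(cp2 \<times> cp2) set \<Rightarrow> bool" where
  "algebraic_cp2_prod Z \<longleftrightarrow>
     (\<exists>\<P>. finite \<P> \<and> (\<forall>P\<in>\<P>. \<exists>k l. bihomogeneous_poly k l P) \<and>
       (\<forall>z w. z \<noteq> 0 \<longrightarrow> w \<noteq> 0 \<longrightarrow>
         ((proj z, proj w) \<in> Z \<longleftrightarrow> (\<forall>P\<in>\<P>. P z w = 0))))"

section \<open>Rational self-maps\<close>

text \<open>A rational self-map is given by a finite set \<open>S\<close> and a map \<open>f\<close> that is holomorphic on the
  complement of \<open>S\<close>; the values of \<open>f\<close> on \<open>S\<close> carry no meaning and are never used. The set \<open>S\<close>
  contains the indeterminacy points, and may also contain points across which \<open>f\<close> extends.\<close>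

definition rational_self_map :: "cp2 set \<Rightarrow> (cp2 \<Rightarrow> cp2) \<Rightarrow> bool" where
  "rational_self_map S f \<longleftrightarrow>
     finite S \<and> cp2_holomorphic_on f (- S) \<and>
     algebraic_cp2_prod (closure {(p, f p) | p. p \<notin> S})"

text \<open>A point is generic if it lies outside a suitable proper algebraic subset.\<close>

definition has_topological_degree :: "cp2 set \<Rightarrow> (cp2 \<Rightarrow> cp2) \<Rightarrow> nat \<Rightarrow> bool" where
  "has_topological_degree S f d \<longleftrightarrow>
     (\<exists>Z. algebraic_cp2 Z \<and> Z \<noteq> UNIV \<and>
       (\<forall>q. q \<notin> Z \<longrightarrow> finite {p. p \<notin> S \<and> f p = q} \<and> card {p. p \<notin> S \<and> f p = q} = d))"

text \<open>The point may belong to \<open>S\<close>, provided that \<open>f\<close> extends holomorphically across it.\<close>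

definition holomorphic_fixed_point :: "cp2 set \<Rightarrow> (cp2 \<Rightarrow> cp2) \<Rightarrow> cp2 \<Rightarrow> bool" where
  "holomorphic_fixed_point S f p \<longleftrightarrow>
     (\<exists>U g. p \<in> U \<and> cp2_holomorphic_on g U \<and> (\<forall>q\<in>U - S. g q = f q) \<and> g p = p)"

end

theory Submission
  imports Defs
begin

text \<open>In an affine chart the map is \<open>(x, y) \<mapsto> (x + 1, x y\<^sup>d)\<close>, that is
  \<open>[x : y : w] \<mapsto> [(x + w) w\<^sup>d : x y\<^sup>d : w\<^sup>d\<^sup>+\<^sup>1]\<close>. It translates the pencil of lines through
  \<open>[0 : 1 : 0]\<close>, so there is no fixed point with \<open>w \<noteq> 0\<close>, and it contracts the line \<open>w = 0\<close> to
  \<open>[0 : 1 : 0]\<close>, which is itself an indeterminacy point. At the two indeterminacy points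
  \<open>[1 : 0 : 0]\<close> and \<open>[0 : 1 : 0]\<close> a continuous extension would have to take the values
  \<open>[0 : 1 : 0]\<close> and \<open>[1 : 0 : 1]\<close>, the constant values of the map along the lines \<open>w = 0\<close> and
  \<open>x = 0\<close>. The closure of the graph is the complete intersection
  \<open>w (a - c) = x c\<close>, \<open>w\<^sup>d b = y\<^sup>d (a - c)\<close> in the target coordinates \<open>[a : b : c]\<close>; a generic
  target point determines \<open>x / w\<close> and leaves \<open>d\<close> roots \<open>y / w\<close>.\<close>

section \<open>Complex differentiability\<close>

text \<open>\<open>has_derivative\<close> already makes g' real linear, so compatibility with
  complex scalars is all that complex linearity still asks for. Values are scalar so that sums,
  products and quotients can be treated one coordinate at a time.\<close>

definition cdiff :: "(complex^'n \<Rightarrow> complex) \<Rightarrow> complex^'n \<Rightarrow> bool" where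
  "cdiff g a \<longleftrightarrow>
     (\<exists>g'. (g has_derivative g') (at a) \<and> (\<forall>c h. g' (c *s h) = c * g' h))"

lemma cdiffI:
  assumes "(g has_derivative g') (at a)" "\<And>c h. g' (c *s h) = c * g' h"
  shows "cdiff g a"
  using assms unfolding cdiff_def by blast

lemma cdiff_const: "cdiff (\<lambda>_. c) a"
  by (rule cdiffI[of _ "\<lambda>_. 0"]) auto

lemma cdiff_nth: "cdiff (\<lambda>v. v $ k) a"
  by (rule cdiffI[OF bounded_linear_imp_has_derivative[OF bounded_linear_vec_nth]]) simp

lemma cdiff_add:
  assumes "cdiff f a" "cdiff g a"
  shows "cdiff (\<lambda>v. f v + g v) a"
proof -
  obtain f' where f: "(f has_derivative f') (at a)" "\<And>c h. f' (c *s h) = c * f' h"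
    using assms(1) unfolding cdiff_def by blast
  obtain g' where g: "(g has_derivative g') (at a)" "\<And>c h. g' (c *s h) = c * g' h"
    using assms(2) unfolding cdiff_def by blast
  show ?thesis
    by (rule cdiffI[OF has_derivative_add[OF f(1) g(1)]]) (simp add: f g algebra_simps)
qed

lemma cdiff_mult:
  assumes "cdiff f a" "cdiff g a"
  shows "cdiff (\<lambda>v. f v * g v) a"
proof -
  obtain f' where f: "(f has_derivative f') (at a)" "\<And>c h. f' (c *s h) = c * f' h"
    using assms(1) unfolding cdiff_def by blast
  obtain g' where g: "(g has_derivative g') (at a)" "\<And>c h. g' (c *s h) = c * g' h"
    using assms(2) unfolding cdiff_def by blast
  show ?thesis
    by (rule cdiffI[OF has_derivative_mult[OF f(1) g(1)]]) (simp add: f g algebra_simps)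
qed

lemma cdiff_power: "cdiff f a \<Longrightarrow> cdiff (\<lambda>v. f v ^ n) a"
  by (induction n) (auto intro: cdiff_const cdiff_mult)

lemma cdiff_inverse:
  assumes "cdiff f a" "f a \<noteq> 0"
  shows "cdiff (\<lambda>v. inverse (f v)) a"
proof -
  obtain f' where f: "(f has_derivative f') (at a)" "\<And>c h. f' (c *s h) = c * f' h"
    using assms(1) unfolding cdiff_def by blast
  show ?thesis
    by (rule cdiffI[OF Deriv.has_derivative_inverse[OF assms(2) f(1)]]) (simp add: f algebra_simps)
qed

lemma cdiff_divide:
  assumes "cdiff f a" "cdiff g a" "g a \<noteq> 0"
  shows "cdiff (\<lambda>v. f v / g v) a"
  using cdiff_mult[OF assms(1) cdiff_inverse[OF assms(2,3)]] by (simp add: divide_inverse)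

lemma cdiff_imp_isCont: "cdiff f a \<Longrightarrow> isCont f a"
  unfolding cdiff_def using has_derivative_continuous by blast

text \<open>The passage from coordinates to the vector derivative of
  \<open>holomorphic_vec_on\<close>: F is the sum of its coordinates placed along the axes by
  bounded linear maps, so the coordinate derivatives assemble in the same way.\<close>

lemma has_complex_linear_derivativeI:
  fixes F :: "complex^'n \<Rightarrow> complex^'m"
  assumes "\<And>j. cdiff (\<lambda>v. F v $ j) a"
  obtains F' where "(F has_derivative F') (at a)" "Vector_Spaces.linear (*s) (*s) F'"
proof -
  have "\<forall>j. \<exists>g'. ((\<lambda>v. F v $ j) has_derivative g') (at a) \<and> (\<forall>c h. g' (c *s h) = c * g' h)"
    using assms unfolding cdiff_def by blast
  then obtain G where G: "\<And>j. ((\<lambda>v. F v $ j) has_derivative G j) (at a)"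
      "\<And>j c h. G j (c *s h) = c * G j h"
    by metis
  have ax: "bounded_linear (axis j :: complex \<Rightarrow> complex^'m)" for j
    by (intro linear_conv_bounded_linear[THEN iffD1] linearI)
      (auto simp: vec_eq_iff axis_def)
  have sum_axis: "(\<Sum>j\<in>UNIV. axis j (x $ j)) = x" for x :: "complex^'m"
    by (simp add: vec_eq_iff axis_def)
  have "((\<lambda>v. \<Sum>j\<in>UNIV. axis j (F v $ j)) has_derivative (\<lambda>h. \<Sum>j\<in>UNIV. axis j (G j h))) (at a)"
    by (intro has_derivative_sum bounded_linear.has_derivative[OF ax] G(1))
  then have "(F has_derivative (\<lambda>h. \<Sum>j\<in>UNIV. axis j (G j h))) (at a)"
    by (simp add: sum_axis)
  moreover have "(\<Sum>j\<in>UNIV. axis j (G j h)) = (\<chi> j. G j h)" for h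
    using sum_axis[of "\<chi> j. G j h"] by simp
  moreover have "G j (x + y) = G j x + G j y" for j x y
    using has_derivative_linear[OF G(1)] by (rule linear_add)
  then have "Vector_Spaces.linear (*s) (*s) (\<lambda>h. \<chi> j. G j h)"
    unfolding Vector_Spaces.linear_iff using vec.vector_space_axioms
    by (auto simp: vec_eq_iff G(2) vector_space_def)
  ultimately show ?thesis using that by simp
qed

lemma cdiff_compose:
  fixes L :: "complex^'n \<Rightarrow> complex^'m"
  assumes "cdiff g (L a)" "\<And>j. cdiff (\<lambda>v. L v $ j) a"
  shows "cdiff (\<lambda>v. g (L v)) a"
proof -
  obtain L' where L: "(L has_derivative L') (at a)" "Vector_Spaces.linear (*s) (*s) L'"
    using has_complex_linear_derivativeI[OF assms(2)] by blast
  obtain g' where g: "(g has_derivative g') (at (L a))" "\<And>c h. g' (c *s h) = c * g' h"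
    using assms(1) unfolding cdiff_def by blast
  have "L' (c *s h) = c *s L' h" for c h
    using L(2) unfolding Vector_Spaces.linear_iff by blast
  then show ?thesis
    by (intro cdiffI[OF has_derivative_compose[OF L(1) g(1)]]) (simp add: g(2))
qed

lemma holomorphic_vec_onI:
  assumes "open A" "\<And>a j. a \<in> A \<Longrightarrow> cdiff (\<lambda>v. F v $ j) a"
  shows "holomorphic_vec_on F A"
  unfolding holomorphic_vec_on_def
proof (intro conjI ballI)
  fix a assume "a \<in> A"
  from has_complex_linear_derivativeI[OF assms(2)[OF this]]
  show "\<exists>F'. (F has_derivative F') (at a) \<and> Vector_Spaces.linear (*s) (*s) F'" by blast
qed (rule assms(1))

lemma tendsto_vector_3:
  fixes x y z :: "'a :: {topological_space, zero}"
  assumes "(f \<longlongrightarrow> x) F" "(g \<longlongrightarrow> y) F" "(h \<longlongrightarrow> z) F"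
  shows "((\<lambda>t. vector [f t, g t, h t] :: 'a^3) \<longlongrightarrow> vector [x, y, z]) F"
proof (rule vec_tendstoI)
  fix i :: 3
  show "((\<lambda>t. (vector [f t, g t, h t] :: 'a^3) $ i) \<longlongrightarrow> (vector [x, y, z] :: 'a^3) $ i) F"
    using exhaust_3[of i] assms by auto
qed

section \<open>Topology of the projective plane\<close>

lemma proj_cases:
  obtains v where "v \<noteq> 0" "p = proj v"
  using hom_coords_nonzero proj_hom_coords by metis

lemma open_proj_vimage: "open U \<Longrightarrow> open {v. v \<noteq> 0 \<and> proj v \<in> U}"
  by (simp add: open_cp2_def)

lemma proj_scale: "c \<noteq> 0 \<Longrightarrow> v \<noteq> 0 \<Longrightarrow> proj (c *s v) = proj v"
  using proj_eq_iff[of v "c *s v"] by (auto simp: vec_eq_iff)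

text \<open>The cone over the image is the union of the preimages of U under all nonzero scalings,
  and each scaling is continuous.\<close>

lemma open_proj_image:
  assumes "open U" "0 \<notin> U"
  shows "open (proj ` U)"
proof -
  have cont: "continuous_on UNIV (\<lambda>v :: complex^3. c *s v)" for c
    by (intro linear_continuous_on linear_conv_bounded_linear[THEN iffD1] linearI)
      (auto simp: vec_eq_iff algebra_simps)
  have "{v. v \<noteq> 0 \<and> proj v \<in> proj ` U} = (\<Union>c\<in>-{0}. (\<lambda>v. c *s v) -` U)"
  proof (intro equalityI subsetI)
    fix v assume "v \<in> {v. v \<noteq> 0 \<and> proj v \<in> proj ` U}"
    then obtain u where "v \<noteq> 0" "u \<in> U" "proj v = proj u" by auto
    then show "v \<in> (\<Union>c\<in>-{0}. (\<lambda>v. c *s v) -` U)"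
      using assms(2) proj_eq_iff[of v u] by auto
  next
    fix v assume "v \<in> (\<Union>c\<in>-{0}. (\<lambda>v. c *s v) -` U)"
    then obtain c where "c \<noteq> 0" "c *s v \<in> U" by auto
    moreover from this have "v \<noteq> 0" using assms(2) by auto
    ultimately show "v \<in> {v. v \<noteq> 0 \<and> proj v \<in> proj ` U}"
      using proj_scale[of c v] by (auto intro!: image_eqI[of _ proj "c *s v"])
  qed
  moreover have "open (\<Union>c\<in>-{0}. (\<lambda>v. c *s v) -` U)"
    using assms(1) cont by (intro open_UN ballI open_vimage) auto
  ultimately show ?thesis by (simp add: open_cp2_def)
qed

lemma tendsto_proj:
  assumes "(f \<longlongrightarrow> v) F" "v \<noteq> 0"
  shows "((\<lambda>t. proj (f t)) \<longlongrightarrow> proj v) F"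
proof (rule topological_tendstoI)
  fix U assume U: "open U" "proj v \<in> U"
  have "\<forall>\<^sub>F t in F. f t \<in> {v. v \<noteq> 0 \<and> proj v \<in> U}"
    using topological_tendstoD[OF assms(1) open_proj_vimage[OF U(1)]] U(2) assms(2) by simp
  then show "\<forall>\<^sub>F t in F. proj (f t) \<in> U" by eventually_elim simp
qed

text \<open>Closed points serve twice: they make the complement of the finite indeterminacy set
  open, and they determine the value of a continuous extension from a constant value along a curve.
  The cone over the complement of a point is the complement of a complex line through 0, and such a
  line is closed because it is a real subspace of finite dimension.\<close>

instance cp2 :: t1_space
proof
  fix p q :: cp2 assume "p \<noteq> q"
  obtain u where u: "u \<noteq> 0" "q = proj u" by (rule proj_cases)
  have "subspace (range (\<lambda>c. c *s u))"
    unfolding subspace_def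
  proof (intro conjI allI ballI)
    show "0 \<in> range (\<lambda>c. c *s u)" by (rule image_eqI[of _ _ 0]) auto
  next
    fix x y assume "x \<in> range (\<lambda>c. c *s u)" "y \<in> range (\<lambda>c. c *s u)"
    then obtain b c where "x = b *s u" "y = c *s u" by auto
    then have "x + y = (b + c) *s u" by (simp add: vec_eq_iff distrib_right)
    then show "x + y \<in> range (\<lambda>c. c *s u)" by blast
  next
    fix r :: real and x assume "x \<in> range (\<lambda>c. c *s u)"
    then obtain c where "x = c *s u" by auto
    then have "r *\<^sub>R x = (of_real r * c) *s u"
      by (simp add: vec_eq_iff scaleR_conv_of_real[of r "_ :: complex"] mult.assoc)
    then show "r *\<^sub>R x \<in> range (\<lambda>c. c *s u)" by blast
  qed
  then have "open (- range (\<lambda>c. c *s u))" using closed_subspace by blast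
  moreover have "{v. v \<noteq> 0 \<and> proj v \<in> - {q}} = - range (\<lambda>c. c *s u)"
  proof (intro equalityI subsetI)
    fix v assume v: "v \<in> {v. v \<noteq> 0 \<and> proj v \<in> - {q}}"
    then have "v \<noteq> c *s u" for c using proj_scale[of c u] u by (cases "c = 0") auto
    then show "v \<in> - range (\<lambda>c. c *s u)" by auto
  next
    fix v assume v: "v \<in> - range (\<lambda>c. c *s u)"
    then have "v \<noteq> 0" using image_eqI[of v "\<lambda>c. c *s u" 0 UNIV] by auto
    moreover have "proj u \<noteq> proj v" using v u calculation proj_eq_iff[of u v] by auto
    ultimately show "v \<in> {v. v \<noteq> 0 \<and> proj v \<in> - {q}}" using u by auto
  qed
  ultimately have "open (- {q})" by (simp add: open_cp2_def)
  then show "\<exists>U. open U \<and> p \<in> U \<and> q \<notin> U" using \<open>p \<noteq> q\<close> by blast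
qed

text \<open>Closedness follows from \<open>proj\<close> being an open map.\<close>

lemma closed_prod_if_closed_lift:
  assumes P: "\<And>z w. z \<noteq> 0 \<Longrightarrow> w \<noteq> 0 \<Longrightarrow> (proj z, proj w) \<in> Z \<longleftrightarrow> (z, w) \<in> C"
    and C: "closed C"
  shows "closed Z"
  unfolding closed_def open_subopen[of "- Z"]
proof
  fix x assume x: "x \<in> - Z"
  obtain z where z: "z \<noteq> 0" "fst x = proj z" by (rule proj_cases)
  obtain w where w: "w \<noteq> 0" "snd x = proj w" by (rule proj_cases)
  have x_eq: "x = (proj z, proj w)" using z(2) w(2) by (cases x) simp
  have "open (- C)" "(z, w) \<in> - C" using C P[OF z(1) w(1)] x x_eq by auto
  then obtain A B where AB: "open A" "open B" "(z, w) \<in> A \<times> B" "A \<times> B \<subseteq> - C"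
    by (rule open_prod_elim)
  \<comment> \<open>The origin is removed because \<open>open_proj_image\<close> applies only away
    from it.\<close>
  have "open (proj ` (A - {0}) \<times> proj ` (B - {0}))"
    using AB by (intro open_Times open_proj_image) (auto intro: open_delete)
  moreover have "x \<in> proj ` (A - {0}) \<times> proj ` (B - {0})"
    using AB z w x_eq by auto
  moreover have "proj ` (A - {0}) \<times> proj ` (B - {0}) \<subseteq> - Z"
    using AB(4) P by auto
  ultimately show "\<exists>T. open T \<and> x \<in> T \<and> T \<subseteq> - Z" by blast
qed

section \<open>Maps induced by homogeneous lifts\<close>

text \<open>The representative inside \<open>affine_param\<close>, kept unprojected so that a
  homogeneous lift can be composed with it and differentiated.\<close>

definition affine_lift :: "3 \<Rightarrow> complex^2 \<Rightarrow> complex^3" where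
  "affine_lift i a =
     (if i = 1 then vector [1, a$1, a$2]
      else if i = 2 then vector [a$1, 1, a$2]
      else vector [a$1, a$2, 1])"

lemma affine_param_eq_proj_lift: "affine_param i a = proj (affine_lift i a)"
  by (simp add: affine_param_def affine_lift_def)

lemma affine_lift_nonzero: "affine_lift i a \<noteq> 0"
  by (simp add: affine_lift_def affine_vector_nonzero)

lemma cdiff_affine_lift: "cdiff (\<lambda>a. affine_lift i a $ j) a"
  using exhaust_3[of i] exhaust_3[of j]
  by (elim disjE) (simp_all add: affine_lift_def cdiff_const cdiff_nth)

text \<open>All work moves to F. For continuity, the cone over the preimage of B is the preimage
  under F of the cone over B. In charts, f is a ratio of coordinates of F along
  \<open>affine_lift\<close>, and its denominator is nonzero exactly where f lands in the target
  chart.\<close>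

lemma cp2_holomorphic_on_induced:
  fixes F :: "complex^3 \<Rightarrow> complex^3"
  assumes V: "open V"
    and F: "\<And>v j. cdiff (\<lambda>v. F v $ j) v"
    and f: "\<And>v. v \<noteq> 0 \<Longrightarrow> proj v \<in> V \<Longrightarrow> F v \<noteq> 0 \<and> f (proj v) = proj (F v)"
  shows "cp2_holomorphic_on f V"
  unfolding cp2_holomorphic_on_def
proof (intro conjI allI)
  show "open V" by fact
  have contF: "continuous_on A F" for A
  proof -
    have "isCont F v" for v
      unfolding isCont_def by (rule vec_tendstoI) (use cdiff_imp_isCont[OF F] in \<open>simp add: isCont_def\<close>)
    then show ?thesis by (simp add: continuous_at_imp_continuous_on)
  qed
  show "continuous_on V f"
    unfolding continuous_on_open_vimage[OF V]
  proof (intro allI impI)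
    fix B :: "cp2 set" assume "open B"
    have "{v. v \<noteq> 0 \<and> proj v \<in> f -` B \<inter> V} =
        F -` {w. w \<noteq> 0 \<and> proj w \<in> B} \<inter> {v. v \<noteq> 0 \<and> proj v \<in> V}"
    proof (rule set_eqI)
      fix v
      show "v \<in> {v. v \<noteq> 0 \<and> proj v \<in> f -` B \<inter> V} \<longleftrightarrow>
          v \<in> F -` {w. w \<noteq> 0 \<and> proj w \<in> B} \<inter> {v. v \<noteq> 0 \<and> proj v \<in> V}"
        using f[of v] by auto
    qed
    moreover have "open \<dots>"
      by (intro open_Int open_vimage[OF open_proj_vimage contF] open_proj_vimage[OF V] \<open>open B\<close>)
    ultimately show "open (f -` B \<inter> V)" by (simp add: open_cp2_def)
  qed
  fix i j :: 3
  define A where "A = {a. affine_param i a \<in> V \<and> f (affine_param i a) \<in> affine_domain j}"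
  have A_iff: "a \<in> A \<longleftrightarrow> proj (affine_lift i a) \<in> V \<and> F (affine_lift i a) $ j \<noteq> 0" for a
    using f[OF affine_lift_nonzero[of i a]] affine_domain_proj[of "F (affine_lift i a)" j]
    by (auto simp: A_def affine_param_eq_proj_lift)
  have contL: "continuous_on UNIV (affine_lift i)"
  proof -
    have "isCont (affine_lift i) a" for a
      unfolding isCont_def
      by (rule vec_tendstoI) (use cdiff_imp_isCont[OF cdiff_affine_lift] in \<open>simp add: isCont_def\<close>)
    then show ?thesis by (simp add: continuous_at_imp_continuous_on)
  qed
  have FL: "cdiff (\<lambda>a. F (affine_lift i a) $ k) a" for k a
    by (rule cdiff_compose[OF F cdiff_affine_lift])
  have "A = affine_lift i -` {v. v \<noteq> 0 \<and> proj v \<in> V} \<inter>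
      (\<lambda>a. F (affine_lift i a) $ j) -` (- {0})"
    using A_iff affine_lift_nonzero[of i] by auto
  moreover have "open ((\<lambda>a. F (affine_lift i a) $ j) -` (- {0}))"
    using cdiff_imp_isCont[OF FL]
    by (intro open_vimage open_Compl closed_singleton) (simp add: continuous_at_imp_continuous_on)
  moreover have "open (affine_lift i -` {v. v \<noteq> 0 \<and> proj v \<in> V})"
    by (rule open_vimage[OF open_proj_vimage[OF V] contL])
  ultimately have "open A" by (simp only: open_Int)
  have "holomorphic_vec_on (\<lambda>a. affine_coord j (f (affine_param i a))) A"
  proof (rule holomorphic_vec_onI[OF \<open>open A\<close>])
    fix a and k :: 2 assume "a \<in> A"
    define G where "G = (\<lambda>l a. F (affine_lift i a) $ l)"
    have G: "cdiff (\<lambda>a. G l a / G j a) a" for l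
      using A_iff \<open>a \<in> A\<close> FL unfolding G_def by (intro cdiff_divide) auto
    define H where "H = (\<lambda>k a. if j = 1 then (if k = (1::2) then G 2 a / G 1 a else G 3 a / G 1 a)
       else if j = 2 then (if k = 1 then G 1 a / G 2 a else G 3 a / G 2 a)
       else (if k = 1 then G 1 a / G 3 a else G 2 a / G 3 a))"
    have H: "cdiff (H k) a"
      using G exhaust_3[of j] exhaust_2[of k] by (auto simp: H_def)
    have eq: "affine_coord j (f (affine_param i b)) $ k = H k b" if "b \<in> A" for b
    proof -
      have "F (affine_lift i b) \<noteq> 0" "f (affine_param i b) = proj (F (affine_lift i b))"
        using that f[OF affine_lift_nonzero[of i b]] A_iff
        by (auto simp: affine_param_eq_proj_lift)
      then show ?thesis using exhaust_2[of k]
        by (auto simp: affine_coord_proj H_def G_def)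
    qed
    obtain H' where H': "(H k has_derivative H') (at a)" "\<And>c h. H' (c *s h) = c * H' h"
      using H unfolding cdiff_def by blast
    \<comment> \<open>The formula \<open>H\<close> is known to agree with f in charts only on
      \<open>A\<close>, so openness of \<open>A\<close> is what carries the derivative over.\<close>
    have "((\<lambda>v. affine_coord j (f (affine_param i v)) $ k) has_derivative H') (at a)"
      by (rule has_derivative_transform_within_open[OF H'(1) \<open>open A\<close> \<open>a \<in> A\<close>]) (simp add: eq)
    then show "cdiff (\<lambda>v. affine_coord j (f (affine_param i v)) $ k) a"
      using H'(2) by (rule cdiffI)
  qed
  then show "holomorphic_vec_on (\<lambda>a. affine_coord j (f (affine_param i a)))
      {a. affine_param i a \<in> V \<and> f (affine_param i a) \<in> affine_domain j}"
    unfolding A_def .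
qed

section \<open>Homogeneous polynomials\<close>

lemma homogeneous_poly_monomial:
  assumes "e \<in> exponents k"
  shows "homogeneous_poly k (\<lambda>z. c * monomial_fun e z)"
  unfolding homogeneous_poly_def
  by (rule exI[of _ "\<lambda>e'. if e' = e then c else 0"])
    (simp add: if_distrib[of "\<lambda>x. x * _"] finite_exponents assms cong: if_cong)

lemma homogeneous_poly_add:
  assumes "homogeneous_poly k P" "homogeneous_poly k Q"
  shows "homogeneous_poly k (\<lambda>z. P z + Q z)"
proof -
  obtain c where c: "\<And>z. P z = (\<Sum>e\<in>exponents k. c e * monomial_fun e z)"
    using assms(1) unfolding homogeneous_poly_def by blast
  obtain c' where c': "\<And>z. Q z = (\<Sum>e\<in>exponents k. c' e * monomial_fun e z)"
    using assms(2) unfolding homogeneous_poly_def by blast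
  show ?thesis
    unfolding homogeneous_poly_def
    by (rule exI[of _ "\<lambda>e. c e + c' e"]) (simp add: c c' sum.distrib distrib_right)
qed

lemma bihomogeneous_poly_monomial:
  assumes "e \<in> exponents k" "e' \<in> exponents l"
  shows "bihomogeneous_poly k l (\<lambda>z w. c * monomial_fun e z * monomial_fun e' w)"
proof -
  have "(\<Sum>x\<in>exponents k. \<Sum>y\<in>exponents l.
      (if x = e \<and> y = e' then c else 0) * monomial_fun x z * monomial_fun y w) =
      (\<Sum>x\<in>exponents k. if x = e then c * monomial_fun e z * monomial_fun e' w else 0)" for z w
  proof (rule sum.cong)
    fix x
    show "(\<Sum>y\<in>exponents l.
        (if x = e \<and> y = e' then c else 0) * monomial_fun x z * monomial_fun y w) =
        (if x = e then c * monomial_fun e z * monomial_fun e' w else 0)"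
      by (simp add: if_distrib[of "\<lambda>x. x * _"] finite_exponents assms cong: if_cong)
  qed simp
  then show ?thesis
    unfolding bihomogeneous_poly_def
    by (intro exI[of _ "\<lambda>x y. if x = e \<and> y = e' then c else 0"])
      (simp add: finite_exponents assms)
qed

lemma bihomogeneous_poly_add:
  assumes "bihomogeneous_poly k l P" "bihomogeneous_poly k l Q"
  shows "bihomogeneous_poly k l (\<lambda>z w. P z w + Q z w)"
proof -
  obtain c where c: "\<And>z w. P z w =
      (\<Sum>e\<in>exponents k. \<Sum>e'\<in>exponents l. c e e' * monomial_fun e z * monomial_fun e' w)"
    using assms(1) unfolding bihomogeneous_poly_def by blast
  obtain c' where c': "\<And>z w. Q z w =
      (\<Sum>e\<in>exponents k. \<Sum>e'\<in>exponents l. c' e e' * monomial_fun e z * monomial_fun e' w)"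
    using assms(2) unfolding bihomogeneous_poly_def by blast
  show ?thesis
    unfolding bihomogeneous_poly_def
    by (rule exI[of _ "\<lambda>e e'. c e e' + c' e e'"]) (simp add: c c' sum.distrib distrib_right)
qed

lemma prod_UNIV_3: "prod f (UNIV :: 3 set) = f 1 * f 2 * f 3"
  unfolding UNIV_3 by (simp add: ac_simps)

text \<open>Each term of the two graph equations has this shape, a power of one source coordinate
  times a power of one target coordinate.\<close>

lemma bihomogeneous_poly_nth:
  "bihomogeneous_poly k l (\<lambda>z w. c * z $ i ^ k * w $ j ^ l)"
proof -
  have exp: "(\<lambda>m. if m = i then k else 0) \<in> exponents k" for i :: 3 and k
    by (simp add: exponents_def)
  have mon: "monomial_fun (\<lambda>m. if m = i then k else 0) z = z $ i ^ k" for i :: 3 and k z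
    by (simp add: monomial_fun_def if_distrib[of "\<lambda>e. _ ^ e"] cong: if_cong)
  show ?thesis
    using bihomogeneous_poly_monomial[OF exp[of i k] exp[of j l], of c] by (simp add: mon)
qed

section \<open>A shear without fixed points\<close>

definition shear_lift :: "nat \<Rightarrow> complex^3 \<Rightarrow> complex^3" where
  "shear_lift d v = vector [(v$1 + v$3) * v$3 ^ d, v$1 * v$2 ^ d, v$3 ^ Suc d]"

text \<open>For d > 0 the lift vanishes at both points of \<open>shear_indet\<close>, so the value
  there is the meaningless \<open>proj 0\<close>.\<close>

definition shear :: "nat \<Rightarrow> cp2 \<Rightarrow> cp2" where
  "shear d p = proj (shear_lift d (hom_coords p))"

definition shear_indet :: "cp2 set" where
  "shear_indet = {proj (vector [1, 0, 0]), proj (vector [0, 1, 0])}"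

text \<open>These are the proportions \<open>t$1 - t$3 : t$3 = z$1 : z$3\<close> and
  \<open>t$2 : (t$1 - t$3) = z$2 ^ d : z$3 ^ d\<close> with denominators cleared. In this form they
  still make sense where the lift vanishes.\<close>

definition shear_graph :: "nat \<Rightarrow> ((complex^3) \<times> (complex^3)) set" where
  "shear_graph d = {(z, t). z$3 * (t$1 - t$3) = z$1 * t$3 \<and> z$3 ^ d * t$2 = z$2 ^ d * (t$1 - t$3)}"

lemma vec3_eq_0_iff: "v = 0 \<longleftrightarrow> v$1 = 0 \<and> v$2 = 0 \<and> v$3 = 0" for v :: "complex^3"
  by (simp add: vec_eq_iff forall_3)

lemma shear_lift_nth [simp]:
  "shear_lift d v $ 1 = (v$1 + v$3) * v$3 ^ d"
  "shear_lift d v $ 2 = v$1 * v$2 ^ d"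
  "shear_lift d v $ 3 = v$3 ^ Suc d"
  by (simp_all add: shear_lift_def)

lemma proj_in_shear_indet_iff:
  assumes "v \<noteq> 0"
  shows "proj v \<in> shear_indet \<longleftrightarrow> v$3 = 0 \<and> v$1 * v$2 = 0"
proof
  assume "proj v \<in> shear_indet"
  then show "v$3 = 0 \<and> v$1 * v$2 = 0"
    using assms proj_eq_iff[of "vector [1, 0, 0]" v] proj_eq_iff[of "vector [0, 1, 0]" v]
    by (auto simp: shear_indet_def vec3_eq_0_iff)
next
  assume v: "v$3 = 0 \<and> v$1 * v$2 = 0"
  then consider "v$1 \<noteq> 0" "v = v$1 *s vector [1, 0, 0]" | "v$2 \<noteq> 0" "v = v$2 *s vector [0, 1, 0]"
    using assms by (auto simp: vec_eq_iff forall_3)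
  then show "proj v \<in> shear_indet"
  proof cases
    case 1
    then show ?thesis
      using proj_scale[of "v$1" "vector [1, 0, 0]"] by (simp add: shear_indet_def vec3_eq_0_iff)
  next
    case 2
    then show ?thesis
      using proj_scale[of "v$2" "vector [0, 1, 0]"] by (simp add: shear_indet_def vec3_eq_0_iff)
  qed
qed

lemma shear_lift_nonzero:
  assumes "v \<noteq> 0" "proj v \<notin> shear_indet"
  shows "shear_lift d v \<noteq> 0"
  using assms by (auto simp: proj_in_shear_indet_iff vec3_eq_0_iff)

lemma shear_proj:
  assumes "v \<noteq> 0" "proj v \<notin> shear_indet"
  shows "shear d (proj v) = proj (shear_lift d v)"
proof -
  obtain c where c: "c \<noteq> 0" "hom_coords (proj v) = c *s v"
    using assms(1) by (rule hom_coords_proj)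
  have "shear_lift d (c *s v) = c ^ Suc d *s shear_lift d v"
    by (simp add: vec_eq_iff forall_3 power_mult_distrib algebra_simps)
  then show ?thesis
    using proj_scale[of "c ^ Suc d"] c shear_lift_nonzero[OF assms] by (simp add: shear_def)
qed

text \<open>Away from indeterminacy the two equations have a single projective solution t. If
  \<open>z$3\<close> is nonzero they express t through \<open>t$3\<close>; if \<open>z$3 = 0\<close>
  then \<open>z$1\<close> and \<open>z$2\<close> are nonzero and the equations force
  \<open>t$1 = t$3 = 0\<close>. Closure, degree and fixed points are all computed through this
  equivalence.\<close>

lemma shear_eq_iff:
  assumes z: "z \<noteq> 0" "proj z \<notin> shear_indet" and t: "t \<noteq> 0" and d: "d > 0"
  shows "shear d (proj z) = proj t \<longleftrightarrow> (z, t) \<in> shear_graph d"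
proof -
  have "shear d (proj z) = proj t \<longleftrightarrow> (\<exists>c. c \<noteq> 0 \<and> t = c *s shear_lift d z)"
    using proj_eq_iff[OF shear_lift_nonzero[OF z] t] shear_proj[OF z] by simp
  also have "\<dots> \<longleftrightarrow> (z, t) \<in> shear_graph d"
  proof
    assume "\<exists>c. c \<noteq> 0 \<and> t = c *s shear_lift d z"
    then obtain c where "t = c *s shear_lift d z" by blast
    then show "(z, t) \<in> shear_graph d" by (simp add: shear_graph_def algebra_simps)
  next
    assume "(z, t) \<in> shear_graph d"
    then have E: "z$3 * (t$1 - t$3) = z$1 * t$3" "z$3 ^ d * t$2 = z$2 ^ d * (t$1 - t$3)"
      by (auto simp: shear_graph_def)
    show "\<exists>c. c \<noteq> 0 \<and> t = c *s shear_lift d z"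
    proof (cases "z$3 = 0")
      case False
      have t1: "t$1 = t$3 * (z$1 + z$3) / z$3" using E(1) False by (simp add: field_simps)
      have t2: "t$2 = z$2 ^ d * (t$1 - t$3) / z$3 ^ d" using E(2) False by (simp add: field_simps)
      have diff: "t$1 - t$3 = z$1 * t$3 / z$3" using E(1) False by (simp add: field_simps)
      have "t$3 \<noteq> 0" using t t1 t2 by (auto simp: vec3_eq_0_iff)
      moreover have "t = (t$3 / z$3 ^ Suc d) *s shear_lift d z"
        using False by (simp add: vec_eq_iff forall_3 t2 diff) (simp add: t1)
      ultimately show ?thesis using False by (intro exI[of _ "t$3 / z$3 ^ Suc d"]) simp
    next
      case True
      then have nz: "z$1 \<noteq> 0" "z$2 \<noteq> 0" using z proj_in_shear_indet_iff by auto
      have t3: "t$3 = 0" using E(1) True nz by auto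
      have t1: "t$1 = 0" using E(2) True nz t3 d by (simp add: power_0_left)
      \<comment> \<open>Only the second coordinate of the lift survives on this line, and it fixes
        the factor.\<close>
      show ?thesis
        using t t1 t3 nz True d
        by (intro exI[of _ "t$2 / (z$1 * z$2 ^ d)"]) (auto simp: vec_eq_iff forall_3)
    qed
  qed
  finally show ?thesis .
qed

lemma holomorphic_shear: "cp2_holomorphic_on (shear d) (- shear_indet)"
proof (rule cp2_holomorphic_on_induced)
  show "open (- shear_indet)"
    by (intro open_Compl finite_imp_closed) (simp add: shear_indet_def)
  show "cdiff (\<lambda>v. shear_lift d v $ j) v" for v j
    using exhaust_3[of j]
    by (elim disjE; hypsubst; unfold shear_lift_nth) (intro cdiff_add cdiff_mult cdiff_power cdiff_nth)+
next
  fix v :: "complex^3" assume "v \<noteq> 0" "proj v \<in> - shear_indet"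
  then show "shear_lift d v \<noteq> 0 \<and> shear d (proj v) = proj (shear_lift d v)"
    using shear_lift_nonzero shear_proj by blast
qed

section \<open>The closure of the graph\<close>

lemma shear_graph_scale:
  assumes "b \<noteq> 0" "c \<noteq> 0"
  shows "(b *s z, c *s t) \<in> shear_graph d \<longleftrightarrow> (z, t) \<in> shear_graph d"
proof -
  have eqs: "b * z$3 * (c * t$1 - c * t$3) = (b * c) * (z$3 * (t$1 - t$3))"
    "b * z$1 * (c * t$3) = (b * c) * (z$1 * t$3)"
    "(b * z$3) ^ d * (c * t$2) = (b ^ d * c) * (z$3 ^ d * t$2)"
    "(b * z$2) ^ d * (c * t$1 - c * t$3) = (b ^ d * c) * (z$2 ^ d * (t$1 - t$3))"
    by (simp_all add: right_diff_distrib mult.assoc mult.left_commute power_mult_distrib)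
  have "b * c \<noteq> 0" "b ^ d * c \<noteq> 0" using assms by auto
  then show ?thesis
    unfolding shear_graph_def mem_Collect_eq case_prod_conv vector_smult_component eqs
    by (simp only: mult_cancel_left simp_thms)
qed

definition shear_rel :: "nat \<Rightarrow> (cp2 \<times> cp2) set" where
  "shear_rel d = {(p, q). (hom_coords p, hom_coords q) \<in> shear_graph d}"

lemma proj_in_shear_rel_iff:
  assumes "z \<noteq> 0" "t \<noteq> 0"
  shows "(proj z, proj t) \<in> shear_rel d \<longleftrightarrow> (z, t) \<in> shear_graph d"
proof -
  obtain b where "b \<noteq> 0" "hom_coords (proj z) = b *s z" using assms(1) by (rule hom_coords_proj)
  moreover obtain c where "c \<noteq> 0" "hom_coords (proj t) = c *s t"
    using assms(2) by (rule hom_coords_proj)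
  ultimately show ?thesis by (simp add: shear_rel_def shear_graph_scale)
qed

lemma closed_shear_rel: "closed (shear_rel d)"
proof (rule closed_prod_if_closed_lift[OF proj_in_shear_rel_iff])
  have "shear_graph d = {x. fst x $ 3 * (snd x $ 1 - snd x $ 3) = fst x $ 1 * snd x $ 3} \<inter>
      {x. fst x $ 3 ^ d * snd x $ 2 = fst x $ 2 ^ d * (snd x $ 1 - snd x $ 3)}"
    by (auto simp: shear_graph_def)
  also have "closed \<dots>"
    by (intro closed_Int closed_Collect_eq continuous_intros)
  finally show "closed (shear_graph d)" .
qed

lemma algebraic_shear_rel: "algebraic_cp2_prod (shear_rel d)"
proof -
  \<comment> \<open>Coefficients and exponents equal to 1 are written out, and signs are put into
    coefficients, so that each summand matches \<open>bihomogeneous_poly_nth\<close>.\<close>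
  define P where "P = (\<lambda>z :: complex^3. \<lambda>t :: complex^3. 1 * z$3 ^ 1 * t$1 ^ 1 + (-1) * z$3 ^ 1 * t$3 ^ 1
    + (-1) * z$1 ^ 1 * t$3 ^ 1)"
  define Q where "Q = (\<lambda>z :: complex^3. \<lambda>t :: complex^3. 1 * z$3 ^ d * t$2 ^ 1 + (-1) * z$2 ^ d * t$1 ^ 1
    + 1 * z$2 ^ d * t$3 ^ 1)"
  have "bihomogeneous_poly 1 1 P" "bihomogeneous_poly d 1 Q"
    unfolding P_def Q_def by (intro bihomogeneous_poly_add bihomogeneous_poly_nth)+
  moreover have "(z, t) \<in> shear_graph d \<longleftrightarrow> P z t = 0 \<and> Q z t = 0" for z t
    by (auto simp: shear_graph_def P_def Q_def algebra_simps eq_diff_eq)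
  ultimately show ?thesis
    unfolding algebraic_cp2_prod_def
    by (intro exI[of _ "{P, Q}"]) (auto simp: proj_in_shear_rel_iff)
qed

text \<open>Points over an indeterminacy point are reached along explicit curves. The target gets a
  lift of its own, \<delta>, because \<open>shear_lift d (\<gamma> s)\<close> tends to 0 there;
  \<delta> is that vector with the vanishing common factor divided out.\<close>

lemma in_closure_shear_graphI:
  fixes \<gamma> \<delta> :: "complex \<Rightarrow> complex^3"
  assumes d: "d > 0"
    and lim: "(\<gamma> \<longlongrightarrow> z) (at 0)" "(\<delta> \<longlongrightarrow> t) (at 0)" "z \<noteq> 0" "t \<noteq> 0"
    and graph: "\<And>s. s \<noteq> 0 \<Longrightarrow> \<gamma> s \<noteq> 0 \<and> \<delta> s \<noteq> 0 \<and> \<not> (\<gamma> s $ 3 = 0 \<and> \<gamma> s $ 1 * \<gamma> s $ 2 = 0)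
      \<and> (\<gamma> s, \<delta> s) \<in> shear_graph d"
  shows "(proj z, proj t) \<in> closure {(p, shear d p) | p. p \<notin> shear_indet}"
proof (rule Lim_in_closed_set[where F = "at (0::complex)"])
  show "((\<lambda>s. (proj (\<gamma> s), proj (\<delta> s))) \<longlongrightarrow> (proj z, proj t)) (at 0)"
    by (intro tendsto_Pair tendsto_proj lim)
  have "(proj (\<gamma> s), proj (\<delta> s)) \<in> closure {(p, shear d p) | p. p \<notin> shear_indet}"
    if "s \<noteq> 0" for s
  proof (rule subsetD[OF closure_subset])
    have "proj (\<gamma> s) \<notin> shear_indet"
      using graph[OF that] by (simp add: proj_in_shear_indet_iff)
    moreover from this have "shear d (proj (\<gamma> s)) = proj (\<delta> s)"
      using graph[OF that] d by (simp add: shear_eq_iff)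
    ultimately show "(proj (\<gamma> s), proj (\<delta> s)) \<in> {(p, shear d p) | p. p \<notin> shear_indet}"
      by (intro CollectI exI[of _ "proj (\<gamma> s)"]) simp
  qed
  then show "\<forall>\<^sub>F s in at 0. (proj (\<gamma> s), proj (\<delta> s)) \<in>
      closure {(p, shear d p) | p. p \<notin> shear_indet}"
    by (simp add: eventually_at_filter)
qed auto

lemma vector_3_eta: "vector [v$1, v$2, v$3] = (v :: complex^3)"
  by (simp add: vec_eq_iff forall_3)

text \<open>The relation is closed and agrees with the graph off the indeterminacy points, so only
  its fibres over these need to be approximated. They are the lines \<open>t$3 = 0\<close> over
  [1 : 0 : 0] and \<open>t$1 = t$3\<close> over [0 : 1 : 0].\<close>

lemma closure_shear_graph:
  assumes d: "d > 0"
  shows "closure {(p, shear d p) | p. p \<notin> shear_indet} = shear_rel d" (is "closure ?G = _")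
proof
  have "?G \<subseteq> shear_rel d"
  proof
    fix x assume "x \<in> ?G"
    then obtain p where p: "x = (p, shear d p)" "p \<notin> shear_indet" by blast
    obtain z where z: "z \<noteq> 0" "p = proj z" by (rule proj_cases)
    obtain t where t: "t \<noteq> 0" "shear d p = proj t" by (rule proj_cases)
    show "x \<in> shear_rel d"
      using p z t d shear_eq_iff[of z t d] by (simp add: proj_in_shear_rel_iff)
  qed
  then show "closure ?G \<subseteq> shear_rel d"
    by (rule closure_minimal) (rule closed_shear_rel)
  show "shear_rel d \<subseteq> closure ?G"
  proof
    fix x assume x: "x \<in> shear_rel d"
    obtain z where z: "z \<noteq> 0" "fst x = proj z" by (rule proj_cases)
    obtain t where t: "t \<noteq> 0" "snd x = proj t" by (rule proj_cases)
    have x_eq: "x = (proj z, proj t)" using z(2) t(2) by (cases x) simp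
    consider "proj z \<notin> shear_indet" | "proj z = proj (vector [1, 0, 0])"
      | "proj z = proj (vector [0, 1, 0])"
      unfolding shear_indet_def by blast
    then show "x \<in> closure ?G"
    proof cases
      case 1
      then have "shear d (proj z) = proj t"
        using x z t d by (simp add: x_eq proj_in_shear_rel_iff shear_eq_iff)
      then have "x = (proj z, shear d (proj z))" using x_eq by simp
      then have "x \<in> ?G" using 1 by (intro CollectI exI[of _ "proj z"] conjI)
      then show ?thesis by (rule subsetD[OF closure_subset])
    next
      case 2
      then have "(vector [1, 0, 0], t) \<in> shear_graph d"
        using x t proj_in_shear_rel_iff[of "vector [1, 0, 0]" t d]
        by (simp add: x_eq vec3_eq_0_iff)
      then have t3: "t$3 = 0" by (simp add: shear_graph_def)
      have "(proj (vector [1, 0, 0]), proj t) \<in> closure ?G"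
      proof (cases "t$1 = 0")
        case True
        \<comment> \<open>Here the target is [0 : 1 : 0], to which the line \<open>z$3 = 0\<close>
          is contracted, so the source may move inside that line.\<close>
        show ?thesis
        proof (rule in_closure_shear_graphI[OF d, where \<gamma> = "\<lambda>s. vector [1, s, 0]" and \<delta> = "\<lambda>s. t"])
          show "((\<lambda>s::complex. vector [1, s, 0] :: complex^3) \<longlongrightarrow> vector [1, 0, 0]) (at 0)"
            by (intro tendsto_vector_3) (auto intro!: tendsto_eq_intros)
        qed (use t t3 True d in \<open>auto simp: vec3_eq_0_iff shear_graph_def\<close>)
      next
        case False
        \<comment> \<open>Along [1 : s r : s] the lift divided by \<open>s ^ d\<close> is
          [1 + s : \<open>r ^ d\<close> : s]. Its limit is [1 : \<open>r ^ d\<close> : 0], which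
          dictates r; multiplying by \<open>t$1\<close> gives \<delta>.\<close>
        obtain r where r: "t$2 / t$1 = r ^ d"
          using d exists_complex_root[of d "t$2 / t$1"] by blast
        show ?thesis
        proof (rule in_closure_shear_graphI[OF d, where \<gamma> = "\<lambda>s. vector [1, s * r, s]"
              and \<delta> = "\<lambda>s. vector [t$1 * (1 + s), t$2, t$1 * s]"])
          show "((\<lambda>s::complex. vector [1, s * r, s] :: complex^3) \<longlongrightarrow> vector [1, 0, 0]) (at 0)"
            by (intro tendsto_vector_3) (auto intro!: tendsto_eq_intros)
          have "((\<lambda>s. vector [t$1 * (1 + s), t$2, t$1 * s] :: complex^3)
              \<longlongrightarrow> vector [t$1, t$2, t$3]) (at 0)"
            by (intro tendsto_vector_3) (auto intro!: tendsto_eq_intros simp: t3)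
          then show "((\<lambda>s. vector [t$1 * (1 + s), t$2, t$1 * s]) \<longlongrightarrow> t) (at 0)"
            by (simp only: vector_3_eta)
          have "t$2 = r ^ d * t$1" using r False by (simp add: field_simps)
          then show "s \<noteq> 0 \<Longrightarrow> (vector [1, s * r, s] :: complex^3) \<noteq> 0 \<and>
              (vector [t$1 * (1 + s), t$2, t$1 * s] :: complex^3) \<noteq> 0 \<and>
              \<not> ((vector [1, s * r, s] :: complex^3) $ 3 = 0 \<and>
                (vector [1, s * r, s] :: complex^3) $ 1 * (vector [1, s * r, s] :: complex^3) $ 2 = 0) \<and>
              (vector [1, s * r, s], vector [t$1 * (1 + s), t$2, t$1 * s]) \<in> shear_graph d" for s
            using False by (simp add: vec3_eq_0_iff shear_graph_def algebra_simps power_mult_distrib)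
        qed (use t in \<open>auto simp: vec3_eq_0_iff\<close>)
      qed
      then show ?thesis using 2 by (simp add: x_eq)
    next
      case 3
      then have "(vector [0, 1, 0], t) \<in> shear_graph d"
        using x t proj_in_shear_rel_iff[of "vector [0, 1, 0]" t d]
        by (simp add: x_eq vec3_eq_0_iff)
      then have t1: "t$1 = t$3" using d by (simp add: shear_graph_def power_0_left)
      \<comment> \<open>Along [u : 1 : s] the lift is
        \<open>[(u + s) * s ^ d : u : s ^ Suc d]\<close>, so the order at which u vanishes selects
        the limit. Order d leads to the point [0 : 1 : 0] of the fibre; the multiple
        \<open>t$2 / t$3\<close> of \<open>s ^ Suc d\<close> leads to every other point.\<close>
      have "(proj (vector [0, 1, 0]), proj t) \<in> closure ?G"
      proof (cases "t$3 = 0")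
        case True
        then have "t$2 \<noteq> 0" using t t1 by (simp add: vec3_eq_0_iff)
        show ?thesis
        proof (rule in_closure_shear_graphI[OF d, where \<gamma> = "\<lambda>s. vector [s ^ d * t$2, 1, s]"
              and \<delta> = "\<lambda>s. vector [s + s ^ d * t$2, t$2, s]"])
          show "((\<lambda>s. vector [s ^ d * t$2, 1, s] :: complex^3) \<longlongrightarrow> vector [0, 1, 0]) (at 0)"
            using d by (intro tendsto_vector_3) (auto intro!: tendsto_eq_intros)
          have "((\<lambda>s. vector [s + s ^ d * t$2, t$2, s] :: complex^3)
              \<longlongrightarrow> vector [t$1, t$2, t$3]) (at 0)"
            using d by (intro tendsto_vector_3) (auto intro!: tendsto_eq_intros simp: t1 True)
          then show "((\<lambda>s. vector [s + s ^ d * t$2, t$2, s]) \<longlongrightarrow> t) (at 0)"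
            by (simp only: vector_3_eta)
        qed (use t in \<open>auto simp: vec3_eq_0_iff shear_graph_def\<close>)
      next
        case False
        show ?thesis
        proof (rule in_closure_shear_graphI[OF d,
              where \<gamma> = "\<lambda>s. vector [s ^ Suc d * t$2 / t$3, 1, s]"
                and \<delta> = "\<lambda>s. vector [t$3 + s ^ d * t$2, t$2, t$3]"])
          show "((\<lambda>s. vector [s ^ Suc d * t$2 / t$3, 1, s] :: complex^3)
              \<longlongrightarrow> vector [0, 1, 0]) (at 0)"
            using d False by (intro tendsto_vector_3) (auto intro!: tendsto_eq_intros)
          have "((\<lambda>s. vector [t$3 + s ^ d * t$2, t$2, t$3] :: complex^3)
              \<longlongrightarrow> vector [t$1, t$2, t$3]) (at 0)"
            using d by (intro tendsto_vector_3) (auto intro!: tendsto_eq_intros simp: t1)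
          then show "((\<lambda>s. vector [t$3 + s ^ d * t$2, t$2, t$3]) \<longlongrightarrow> t) (at 0)"
            by (simp only: vector_3_eta)
        qed (use t False in \<open>auto simp: vec3_eq_0_iff shear_graph_def\<close>)
      qed
      then show ?thesis using 3 by (simp add: x_eq)
    qed
  qed
qed

lemma rational_self_map_shear: "d > 0 \<Longrightarrow> rational_self_map shear_indet (shear d)"
  unfolding rational_self_map_def
  by (simp add: closure_shear_graph algebraic_shear_rel holomorphic_shear)
    (simp add: shear_indet_def)

section \<open>The topological degree\<close>

lemma topological_degree_shear:
  assumes d: "d > 0"
  shows "has_topological_degree shear_indet (shear d) d"
proof -
  \<comment> \<open>The discarded targets form three lines. Off them
    \<open>t$2 / (t$1 - t$3)\<close> is defined and nonzero, hence has exactly d distinct d-th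
    roots, and \<open>(t$1 - t$3) / t$3\<close> is defined.\<close>
  define P where "P = (\<lambda>t :: complex^3. t$2 * t$3 * (t$1 - t$3))"
  define Z where "Z = {q. P (hom_coords q) = 0}"
  have Z: "proj t \<in> Z \<longleftrightarrow> P t = 0" if t: "t \<noteq> 0" for t
  proof -
    obtain c where "c \<noteq> 0" "hom_coords (proj t) = c *s t" using t by (rule hom_coords_proj)
    moreover have "P (c *s t) = c ^ 3 * P t"
      by (simp add: P_def power3_eq_cube algebra_simps)
    ultimately show ?thesis by (simp add: Z_def)
  qed
  have "homogeneous_poly 3 (\<lambda>t. 1 * monomial_fun (\<lambda>i. 1) t +
      (-1) * monomial_fun (\<lambda>i. if i = 1 then 0 else if i = 2 then 1 else 2) t)"
    by (intro homogeneous_poly_add homogeneous_poly_monomial) (simp_all add: exponents_def sum_3)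
  moreover have "monomial_fun (\<lambda>i. 1) t = t$1 * t$2 * t$3" for t :: "complex^3"
    by (simp add: monomial_fun_def prod_UNIV_3)
  moreover have "monomial_fun (\<lambda>i. if i = 1 then 0 else if i = 2 then 1 else 2) t = t$2 * (t$3 * t$3)"
    for t :: "complex^3"
    by (simp add: monomial_fun_def prod_UNIV_3 power2_eq_square)
  moreover have "P t = 1 * (t$1 * t$2 * t$3) + (-1) * (t$2 * (t$3 * t$3))" for t
    by (simp add: P_def algebra_simps)
  then have "P = (\<lambda>t. 1 * (t$1 * t$2 * t$3) + (-1) * (t$2 * (t$3 * t$3)))" by (rule ext)
  ultimately have "homogeneous_poly 3 P" by (simp only:)
  then have "algebraic_cp2 Z"
    unfolding algebraic_cp2_def using Z by (intro exI[of _ "{P}"]) auto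
  moreover have "proj (vector [2, 1, 1]) \<notin> Z"
    by (subst Z) (simp_all add: P_def vec3_eq_0_iff)
  moreover have "finite {p. p \<notin> shear_indet \<and> shear d p = q} \<and>
      card {p. p \<notin> shear_indet \<and> shear d p = q} = d" if q: "q \<notin> Z" for q
  proof -
    obtain t where t: "t \<noteq> 0" "q = proj t" by (rule proj_cases)
    then have nz: "t$2 \<noteq> 0" "t$3 \<noteq> 0" "t$1 - t$3 \<noteq> 0" using q Z[OF t(1)] by (auto simp: P_def)
    \<comment> \<open>A preimage normalised to third coordinate 1 has its first coordinate
      determined by t; \<open>R\<close> collects the possible second coordinates and
      \<open>h\<close> rebuilds the point.\<close>
    define R where "R = {y. y ^ d = t$2 / (t$1 - t$3)}"
    define h where "h = (\<lambda>y. vector [(t$1 - t$3) / t$3, y, 1] :: complex^3)"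
    have h0: "h y \<noteq> 0" for y by (simp add: h_def vec3_eq_0_iff)
    have R: "card R = d" unfolding R_def using nz d by (intro card_nth_roots) auto
    have "inj_on (\<lambda>y. proj (h y)) R"
    proof (rule inj_onI)
      fix x y assume "proj (h x) = proj (h y)"
      then obtain c where "h y = c *s h x" using proj_eq_iff[OF h0 h0] by blast
      then have "h y $ 3 = c * h x $ 3" "h y $ 2 = c * h x $ 2" by simp_all
      then show "x = y" by (simp add: h_def)
    qed
    moreover have "{p. p \<notin> shear_indet \<and> shear d p = q} = (\<lambda>y. proj (h y)) ` R"
    proof (intro equalityI subsetI)
      fix p assume "p \<in> {p. p \<notin> shear_indet \<and> shear d p = q}"
      then have p: "p \<notin> shear_indet" "shear d p = q" by auto
      obtain z where z: "z \<noteq> 0" "p = proj z" by (rule proj_cases)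
      have "(z, t) \<in> shear_graph d" using p z t d shear_eq_iff[of z t d] by simp
      then have E: "z$3 * (t$1 - t$3) = z$1 * t$3" "z$3 ^ d * t$2 = z$2 ^ d * (t$1 - t$3)"
        by (auto simp: shear_graph_def)
      have z3: "z$3 \<noteq> 0"
      proof
        assume "z$3 = 0"
        then have "z$1 = 0" "z$2 = 0" using E nz d by (auto simp: power_0_left)
        then show False using \<open>z$3 = 0\<close> z(1) by (simp add: vec3_eq_0_iff)
      qed
      have "z = z$3 *s h (z$2 / z$3)"
        using z3 nz E(1) by (simp add: h_def vec_eq_iff forall_3 field_simps)
      then have "p = proj (h (z$2 / z$3))" using z proj_scale[OF z3 h0] by metis
      moreover have "z$2 / z$3 \<in> R"
        using z3 nz E(2) by (simp add: R_def power_divide field_simps)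
      ultimately show "p \<in> (\<lambda>y. proj (h y)) ` R" by blast
    next
      fix p assume "p \<in> (\<lambda>y. proj (h y)) ` R"
      then obtain y where y: "y \<in> R" "p = proj (h y)" by blast
      have "p \<notin> shear_indet" using y h0 by (simp add: proj_in_shear_indet_iff) (simp add: h_def)
      moreover have "y ^ d * (t$1 - t$3) = t$2" using y nz by (simp add: R_def)
      then have "(h y, t) \<in> shear_graph d" using nz by (simp add: shear_graph_def h_def)
      ultimately show "p \<in> {p. p \<notin> shear_indet \<and> shear d p = q}"
        using y t h0 d shear_eq_iff[of "h y" t d] by simp
    qed
    moreover have "finite R" using R d card_ge_0_finite by metis
    ultimately show ?thesis using R by (simp add: card_image)
  qed
  ultimately show ?thesis unfolding has_topological_degree_def by blast
qed

section \<open>Absence of holomorphic fixed points\<close>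

lemma holomorphic_extension_value:
  fixes \<gamma> :: "complex \<Rightarrow> complex^3"
  assumes g: "cp2_holomorphic_on g U" "\<And>q. q \<in> U - S \<Longrightarrow> g q = f q"
    and z: "z \<noteq> 0" "proj z \<in> U" and lim: "(\<gamma> \<longlongrightarrow> z) (at 0)"
    and f: "\<And>s. s \<noteq> 0 \<Longrightarrow> proj (\<gamma> s) \<notin> S \<and> f (proj (\<gamma> s)) = q"
  shows "g (proj z) = q"
proof -
  have U: "open U" "continuous_on U g" using g(1) by (auto simp: cp2_holomorphic_on_def)
  have lim': "((\<lambda>s. proj (\<gamma> s)) \<longlongrightarrow> proj z) (at 0)" by (rule tendsto_proj[OF lim z(1)])
  show ?thesis
  \<comment> \<open>Otherwise the complement of q would pull back under g to an open neighbourhood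
    of \<open>proj z\<close>. The curve enters it at some nonzero s, yet there g equals f, whose
    value is q.\<close>
  proof (rule ccontr)
    assume "g (proj z) \<noteq> q"
    then have "proj z \<in> g -` (- {q}) \<inter> U" using z(2) by simp
    moreover have "open (g -` (- {q}) \<inter> U)"
      using U continuous_on_open_vimage[OF U(1)] open_Compl[OF closed_singleton] by blast
    ultimately have "\<forall>\<^sub>F s in at 0. proj (\<gamma> s) \<in> g -` (- {q}) \<inter> U"
      by (intro topological_tendstoD[OF lim'])
    then have "\<forall>\<^sub>F s :: complex in at 0. False"
      using eventually_neq_at_within[of 0 0 UNIV] by eventually_elim (use f g(2) in auto)
    then show False by simp
  qed
qed

lemma no_holomorphic_fixed_point_shear:
  assumes d: "d > 0"
  shows "\<not> holomorphic_fixed_point shear_indet (shear d) p"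
proof
  assume "holomorphic_fixed_point shear_indet (shear d) p"
  then obtain U g where g: "p \<in> U" "cp2_holomorphic_on g U" "\<And>q. q \<in> U - shear_indet \<Longrightarrow> g q = shear d q"
      "g p = p"
    unfolding holomorphic_fixed_point_def by blast
  note ext = holomorphic_extension_value[OF g(2,3)]
  consider "p \<notin> shear_indet" | "p = proj (vector [1, 0, 0])" | "p = proj (vector [0, 1, 0])"
    unfolding shear_indet_def by blast
  then show False
  proof cases
    case 1
    obtain z where z: "z \<noteq> 0" "p = proj z" by (rule proj_cases)
    have "shear d (proj z) = proj z" using g 1 z by auto
    then have "(z, z) \<in> shear_graph d" using 1 z d shear_eq_iff[of z z d] by simp
    then have "z$3 = 0" "z$1 * z$2 = 0"
      using d by (auto simp: shear_graph_def algebra_simps power_0_left)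
    then show False using 1 z proj_in_shear_indet_iff by simp
  next
    case 2
    have "g (proj (vector [1, 0, 0])) = proj (vector [0, 1, 0])"
    \<comment> \<open>One curve suffices: it stays in the contracted line and ends at the supposed
      fixed point.\<close>
    proof (rule ext[where \<gamma> = "\<lambda>s. vector [1, s, 0]"])
      show "((\<lambda>s::complex. vector [1, s, 0] :: complex^3) \<longlongrightarrow> vector [1, 0, 0]) (at 0)"
        by (intro tendsto_vector_3) (auto intro!: tendsto_eq_intros)
      fix s :: complex assume "s \<noteq> 0"
      then have "proj (vector [1, s, 0]) \<notin> shear_indet"
        by (subst proj_in_shear_indet_iff) (auto simp: vec3_eq_0_iff)
      then show "proj (vector [1, s, 0]) \<notin> shear_indet \<and>
          shear d (proj (vector [1, s, 0])) = proj (vector [0, 1, 0])"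
        using d by (subst shear_eq_iff) (auto simp: vec3_eq_0_iff shear_graph_def)
    qed (use g 2 in \<open>auto simp: vec3_eq_0_iff\<close>)
    then show False
      using g(4) 2 proj_eq_iff[of "vector [1, 0, 0]" "vector [0, 1, 0]"]
      by (auto simp: vec3_eq_0_iff vec_eq_iff forall_3)
  next
    case 3
    have "g (proj (vector [0, 1, 0])) = proj (vector [1, 0, 1])"
    \<comment> \<open>With first coordinate 0 the lift is \<open>s ^ Suc d\<close> times
      [1 : 0 : 1].\<close>
    proof (rule ext[where \<gamma> = "\<lambda>s. vector [0, 1, s]"])
      show "((\<lambda>s::complex. vector [0, 1, s] :: complex^3) \<longlongrightarrow> vector [0, 1, 0]) (at 0)"
        by (intro tendsto_vector_3) (auto intro!: tendsto_eq_intros)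
      fix s :: complex assume "s \<noteq> 0"
      then have "proj (vector [0, 1, s]) \<notin> shear_indet"
        by (subst proj_in_shear_indet_iff) (auto simp: vec3_eq_0_iff)
      then show "proj (vector [0, 1, s]) \<notin> shear_indet \<and>
          shear d (proj (vector [0, 1, s])) = proj (vector [1, 0, 1])"
        using d by (subst shear_eq_iff) (auto simp: vec3_eq_0_iff shear_graph_def)
    qed (use g 3 in \<open>auto simp: vec3_eq_0_iff\<close>)
    then show False
      using g(4) 3 proj_eq_iff[of "vector [0, 1, 0]" "vector [1, 0, 1]"]
      by (auto simp: vec3_eq_0_iff vec_eq_iff forall_3)
  qed
qed

theorem theorem1p1:
  fixes d :: nat
  assumes "d \<ge> 1"
  shows "\<exists>S f. rational_self_map S f \<and> has_topological_degree S f d \<and>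
           \<not> (\<exists>p. holomorphic_fixed_point S f p)"
  using assms rational_self_map_shear[of d] topological_degree_shear[of d]
    no_holomorphic_fixed_point_shear[of d]
  by (metis less_eq_Suc_le One_nat_def)

end
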